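(* Let $X$ and $Y$ be metrizable spaces. Let $D(X)$ be either $C(X)$ or $C^*(X)$, and, independently, let $D(Y)$ be either $C(Y)$ or $C^*(Y)$. Suppose that $T: D_p(X)\to D_p(Y)$ is an inversely bounded uniformly continuous surjection. If $X$ is a $\Delta_1$-space, then $Y$ is a $\Delta_1$-space.
   Context: $C(X)$ is the linear space of all continuous real-valued functions on $X$, and $C^*(X)\subset C(X)$ is the subspace of bounded functions. $D_p(X)$ denotes $D(X)$ endowed with the topology of pointwise convergence. The choices for $D(X)$ and $D(Y)$ are independent, so all four combinations are covered. A map $T: D_p(X)\to D_p(Y)$ (not necessarily linear) is uniformly continuous if for every neighborhood $U$ of the zero function in $D_p(Y)$ there is a neighborhood $V$ of the zero function in $D_p(X)$ such that $f,g\in D_p(X)$ and $f-g\in V$ imply $T(f)-T(g)\in U$. $\|f\|$ denotes the supremum norm of a bounded function $f$. A sequence $\{g_n: n\in\mathbb N\}$ of bounded continuous functions is norm bounded if there is $M>0$ with $\|g_n\|\le M$ for all $n$. A map $T: D(X)\to D(Y)$ is inversely bounded if for every norm bounded sequence $\{g_n\}\subset C^*(Y)$ there is a norm bounded sequence $\{f_n\}\subset C^*(X)$ with $T(f_n)=g_n$ for each $n\in\mathbb N$. A topological space $X$ is a $\Delta_1$-space if any disjoint sequence $\{A_n: n\in\mathbb N\}$ of countable subsets of $X$ has a point-finite open expansion, i.e. there exists a point-finite sequence $\{U_n: n\in\mathbb N\}$ of open subsets of $X$ (each point of $X$ belongs to $U_n$ for only finitely many $n$) such that $A_n\subseteq U_n$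 for each $n\in\mathbb N$. *)

theory Defs
  imports "HOL-Analysis.Analysis"
begin

text \<open>Functions on \<open>topspace X\<close> are represented as elements of \<open>extensional (topspace X)\<close>, so that
  equality in HOL is equality of functions on the space. The linear structure is
  therefore given by pointwise operations restricted to \<open>topspace X\<close>.\<close>

definition C_space :: "'a topology \<Rightarrow> ('a \<Rightarrow> real) set" where
  "C_space X = {f \<in> extensional (topspace X). continuous_map X euclideanreal f}"

definition Cb_space :: "'a topology \<Rightarrow> ('a \<Rightarrow> real) set" where
  "Cb_space X = {f \<in> C_space X. bounded (f ` topspace X)}"

definition pointwise_topology :: "'a topology \<Rightarrow> ('a \<Rightarrow> real) set \<Rightarrow> ('a \<Rightarrow> real) topology" where
  "pointwise_topology X D = subtopology (product_topology (\<lambda>_. euclideanreal) (topspace X)) D"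

definition zero_fun :: "'a topology \<Rightarrow> 'a \<Rightarrow> real" where
  "zero_fun X = (\<lambda>x\<in>topspace X. 0)"

definition diff_fun :: "'a topology \<Rightarrow> ('a \<Rightarrow> real) \<Rightarrow> ('a \<Rightarrow> real) \<Rightarrow> 'a \<Rightarrow> real" where
  "diff_fun X f g = (\<lambda>x\<in>topspace X. f x - g x)"

definition unif_continuous_Dp ::
  "'a topology \<Rightarrow> ('a \<Rightarrow> real) set \<Rightarrow> 'b topology \<Rightarrow> ('b \<Rightarrow> real) set
    \<Rightarrow> (('a \<Rightarrow> real) \<Rightarrow> ('b \<Rightarrow> real)) \<Rightarrow> bool" where
  "unif_continuous_Dp X DX Y DY T \<longleftrightarrow>
     T \<in> DX \<rightarrow> DY \<and>
     (\<forall>U. openin (pointwise_topology Y DY) U \<and> zero_fun Y \<in> U \<longrightarrow>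
       (\<exists>V. openin (pointwise_topology X DX) V \<and> zero_fun X \<in> V \<and>
         (\<forall>f\<in>DX. \<forall>g\<in>DX. diff_fun X f g \<in> V \<longrightarrow> diff_fun Y (T f) (T g) \<in> U)))"

text \<open>Inserting \<open>0\<close> only matters for the empty space, where \<open>Sup {}\<close> is unspecified in type
  \<open>real\<close>. The value is meaningful for bounded functions only.\<close>

definition sup_norm :: "'a topology \<Rightarrow> ('a \<Rightarrow> real) \<Rightarrow> real" where
  "sup_norm X f = Sup (insert 0 ((\<lambda>x. \<bar>f x\<bar>) ` topspace X))"

definition norm_bounded_seq :: "'a topology \<Rightarrow> (nat \<Rightarrow> 'a \<Rightarrow> real) \<Rightarrow> bool" where
  "norm_bounded_seq X g \<longleftrightarrow>
     (\<forall>n. g n \<in> Cb_space X) \<and> (\<exists>M>0. \<forall>n. sup_norm X (g n) \<le> M)"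

definition inversely_bounded ::
  "'a topology \<Rightarrow> 'b topology \<Rightarrow> (('a \<Rightarrow> real) \<Rightarrow> ('b \<Rightarrow> real)) \<Rightarrow> bool" where
  "inversely_bounded X Y T \<longleftrightarrow>
     (\<forall>g. norm_bounded_seq Y g \<longrightarrow> (\<exists>f. norm_bounded_seq X f \<and> (\<forall>n. T (f n) = g n)))"

definition Delta1_space :: "'a topology \<Rightarrow> bool" where
  "Delta1_space X \<longleftrightarrow>
     (\<forall>A :: nat \<Rightarrow> 'a set.
       (\<forall>n. A n \<subseteq> topspace X \<and> countable (A n)) \<and> disjoint_family A \<longrightarrow>
       (\<exists>U :: nat \<Rightarrow> 'a set.
         (\<forall>n. openin X (U n) \<and> A n \<subseteq> U n) \<and>
         (\<forall>x\<in>topspace X. finite {n. x \<in> U n})))"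

end

theory Submission imports Defs begin

text \<open>A metrizable space is a \<open>\<Delta>\<^sub>1\<close>-space iff all its countable subsets are \<open>G\<^sub>\<delta>\<close>, so it suffices to
  transfer the latter property from \<open>X\<close> to \<open>Y\<close>. By uniform continuity every \<open>y\<close> has a finite support:
  a set \<open>K \<subseteq> X\<close> and a bound \<open>p\<close> such that \<open>\<bar>f - g\<bar> < 1\<close> on \<open>K\<close> implies \<open>\<bar>T f y - T g y\<bar> \<le> p\<close>. For given
  \<open>p\<close> and \<open>q\<close>, the points with a support of bound \<open>p\<close> and fewer than \<open>q\<close> elements form a closed set, so the
  points with a support of bound \<open>p\<close> and at most \<open>q\<close> elements, but none of bound \<open>2p\<close> with fewer than \<open>q\<close>
  elements, form an \<open>F\<^sub>\<sigma>\<close> set. These sets cover \<open>Y\<close>. On each of them the support of bound \<open>p\<close> and size \<open>q\<close> is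
  unique and depends continuously on the point, and by inverse boundedness only finitely many
  points share a given support. Hence a countable subset \<open>C\<close> of such a piece lies in the countable
  set of points whose support is contained in the countable \<open>G\<^sub>\<delta>\<close> set \<open>\<Union>\<^bsub>y \<in> C\<^esub> K(y)\<close>, and this set
  is \<open>G\<^sub>\<delta>\<close> in the piece.\<close>

section \<open>Countable sets in metrizable spaces\<close>

text \<open>A point lies in only finitely many of the sets expanding the single points of
  \<open>C\<close>, so the tail unions of the expansion have empty intersection. Adding to each tail
  the finitely many earlier points of \<open>C\<close> leaves exactly \<open>C\<close> as the
  intersection.\<close>

lemma Delta1_imp_countable_gdelta_in:
  assumes "metrizable_space X" "Delta1_space X" "countable C" "C \<subseteq> topspace X"
  shows "gdelta_in X C"
proof -
  \<comment> \<open>\<open>A n\<close> holds the point of \<open>C\<close> with number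
    \<open>n\<close>, or is empty once a finite \<open>C\<close> is exhausted, so the sequence is
    infinite in either case.\<close>
  define A where "A n = {x \<in> C. to_nat_on C x = n}" for n
  have A_sub: "A n \<subseteq> {from_nat_into C n}" for n
    using assms(3) by (auto simp: A_def)
  have A_fin: "finite (A n)" for n
    using A_sub finite_subset by blast
  have A_C: "A n \<subseteq> topspace X" for n
    using assms(4) by (auto simp: A_def)
  have "disjoint_family A"
    by (auto simp: disjoint_family_on_def A_def)
  then obtain U where U: "\<And>n. openin X (U n)" "\<And>n. A n \<subseteq> U n"
      "\<And>x. x \<in> topspace X \<Longrightarrow> finite {n. x \<in> U n}"
  proof -
    have "\<forall>n. A n \<subseteq> topspace X \<and> countable (A n)"
      using A_fin A_C by (auto intro: countable_finite)
    with \<open>disjoint_family A\<close> have "\<exists>U. (\<forall>n. openin X (U n) \<and> A n \<subseteq> U n) \<and> (\<forall>x\<in>topspace X. finite {n. x \<in> U n})"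
      by (intro assms(2)[unfolded Delta1_space_def, rule_format, of A] conjI)
    then obtain U where "\<forall>n. openin X (U n) \<and> A n \<subseteq> U n" "\<forall>x\<in>topspace X. finite {n. x \<in> U n}"
      by (elim exE conjE)
    then show thesis by (intro that[of U]) auto
  qed
  define G where "G n = (\<Union>m\<in>{n..}. U m) \<union> (\<Union>m<n. A m)" for n
  have "gdelta_in X (G n)" for n
    unfolding G_def
  proof (rule gdelta_in_Un)
    show "gdelta_in X (\<Union>m\<in>{n..}. U m)"
      using U(1) by (intro open_imp_gdelta_in openin_Union) auto
    have "closedin X (\<Union>m<n. A m)"
      using A_fin A_C metrizable_imp_t1_space[OF assms(1)]
      by (intro closedin_Union) (auto simp: t1_space_closedin_finite)
    then show "gdelta_in X (\<Union>m<n. A m)"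
      using assms(1) by (rule closed_imp_gdelta_in[rotated])
  qed
  then have "gdelta_in X (\<Inter>(range G))"
    by (intro gdelta_in_Inter) auto
  moreover have "\<Inter>(range G) = C"
  proof
    show "C \<subseteq> \<Inter>(range G)"
    proof clarify
      fix x n assume "x \<in> C"
      then have "x \<in> A (to_nat_on C x)" by (simp add: A_def)
      with U(2) show "x \<in> G n"
        by (cases "to_nat_on C x < n") (auto simp: G_def not_less)
    qed
    show "\<Inter>(range G) \<subseteq> C"
    proof
      fix x assume x: "x \<in> \<Inter>(range G)"
      have "x \<in> topspace X"
        using x \<open>gdelta_in X (\<Inter>(range G))\<close> gdelta_in_subset by blast
      then obtain n where "\<And>m. x \<in> U m \<Longrightarrow> m < n"
        using U(3) finite_nat_set_iff_bounded by (metis mem_Collect_eq)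
      then have "x \<notin> (\<Union>m\<in>{n..}. U m)" by (meson UN_E atLeast_iff not_le)
      moreover have "x \<in> G n" using x by blast
      ultimately have "x \<in> (\<Union>m<n. A m)" unfolding G_def by blast
      then show "x \<in> C" by (auto simp: A_def)
    qed
  qed
  ultimately show ?thesis by simp
qed

text \<open>With \<open>C\<close> the union of the \<open>A n\<close> and open \<open>G n\<close>
  decreasing to \<open>C\<close>, point-finiteness can fail only at points of \<open>C\<close>.
  Removing from \<open>G n\<close> the points of \<open>C\<close> numbered up to \<open>n\<close>
  outside \<open>A n\<close> repairs this: a point of \<open>A m\<close> numbered \<open>i\<close>
  stays only in the sets with \<open>n < i\<close> or \<open>n = m\<close>.\<close>

lemma countable_gdelta_in_imp_Delta1:
  assumes "t1_space X"
    and gd: "\<And>C. countable C \<Longrightarrow> C \<subseteq> topspace X \<Longrightarrow> gdelta_in X C"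
  shows "Delta1_space X"
  unfolding Delta1_space_def
proof (intro allI impI, elim conjE)
  fix A :: "nat \<Rightarrow> 'a set"
  assume A: "\<forall>n. A n \<subseteq> topspace X \<and> countable (A n)" and disj: "disjoint_family A"
  define C where "C = \<Union>(range A)"
  have C: "countable C" "C \<subseteq> topspace X"
    using A by (auto simp: C_def)
  obtain G where G: "\<And>n. openin X (G n)" "\<And>n. G (Suc n) \<subseteq> G n" "\<Inter>(range G) = C"
    using gd[OF C] by (auto simp: gdelta_in_descending)
  have G_anti: "G n \<subseteq> G m" if "m \<le> n" for m n
    using G(2) that by (rule lift_Suc_antimono_le)
  define B where "B n = {x \<in> C. to_nat_on C x \<le> n \<and> x \<notin> A n}" for n
  have B_fin: "finite (B n)" for n
  proof -
    have "B n \<subseteq> from_nat_into C ` {..n}"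
      using C(1) by (force simp: B_def)
    then show ?thesis by (rule finite_subset) auto
  qed
  have "openin X (G n - B n)" for n
  proof -
    have "B n \<subseteq> topspace X"
      using C(2) by (auto simp: B_def)
    then have "closedin X (B n)"
      using B_fin assms(1) by (simp add: t1_space_closedin_finite)
    with G(1) show ?thesis by (rule openin_diff)
  qed
  moreover have "A n \<subseteq> G n - B n" for n
    using G(3) by (auto simp: C_def B_def)
  moreover have "finite {n. x \<in> G n - B n}" for x
  proof (cases "x \<in> C")
    case True
    then obtain m where m: "x \<in> A m" by (auto simp: C_def)
    have "{n. x \<in> G n - B n} \<subseteq> insert m {..to_nat_on C x}"
    proof
      fix n assume "n \<in> {n. x \<in> G n - B n}"
      then have "to_nat_on C x > n \<or> x \<in> A n" using True by (auto simp: B_def)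
      moreover have "n = m" if "x \<in> A n"
        using disj m that by (auto simp: disjoint_family_on_def)
      ultimately show "n \<in> insert m {..to_nat_on C x}" by auto
    qed
    then show ?thesis by (rule finite_subset) auto
  next
    case False
    then obtain k where "x \<notin> G k" using G(3) by blast
    then have "{n. x \<in> G n - B n} \<subseteq> {..k}"
      using G_anti[of k] nat_le_linear by blast
    then show ?thesis by (rule finite_subset) auto
  qed
  ultimately show "\<exists>U. (\<forall>n. openin X (U n) \<and> A n \<subseteq> U n) \<and> (\<forall>x\<in>topspace X. finite {n. x \<in> U n})"
    by (intro exI[of _ "\<lambda>n. G n - B n"]) auto
qed

section \<open>Finite sets in metric spaces and dominated functions\<close>

lemma (in Metric_space) finite_separated:
  assumes "finite L" "L \<subseteq> M"
  obtains e where "e > 0" "\<And>x x' z. \<lbrakk>x \<in> L; x' \<in> L; z \<in> M; d x z < e; d x' z < e\<rbrakk> \<Longrightarrow> x = x'"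
proof -
  define S where "S = (\<lambda>(x,x'). d x x' / 2) ` {(x,x') \<in> L \<times> L. x \<noteq> x'}"
  \<comment> \<open>The \<open>1\<close> keeps \<open>Min\<close> defined when \<open>L\<close> has
    fewer than two points.\<close>
  define e where "e = Min (insert 1 S)"
  have fin: "finite (insert 1 S)"
  proof -
    have "finite {(x,x') \<in> L \<times> L. x \<noteq> x'}"
      using assms(1) by (rule_tac finite_subset[of _ "L \<times> L"]) auto
    then show ?thesis by (simp add: S_def)
  qed
  show thesis
  proof
    show "e > 0"
      using fin assms(2) unfolding e_def by (subst Min_gr_iff) (auto simp: S_def subset_iff)
    fix x x' z assume *: "x \<in> L" "x' \<in> L" "z \<in> M" "d x z < e" "d x' z < e"
    show "x = x'"
    proof (rule ccontr)
      assume "x \<noteq> x'"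
      then have "e \<le> d x x' / 2"
        unfolding e_def using fin * by (intro Min_le) (auto simp: S_def intro!: image_eqI[of _ _ "(x,x')"])
      moreover have "d x x' \<le> d x z + d x' z"
        using * assms(2) by (metis commute subset_iff triangle)
      ultimately show False using * by linarith
    qed
  qed
qed

lemma bounded_image_dominated:
  assumes "bounded (f ` S)" "bounded (g ` S)" "\<And>x. x \<in> S \<Longrightarrow> \<bar>k x\<bar> \<le> \<bar>f x\<bar> + \<bar>g x\<bar>"
  shows "bounded ((k :: 'c \<Rightarrow> real) ` S)"
proof -
  obtain a b where "\<And>x. x \<in> S \<Longrightarrow> \<bar>f x\<bar> \<le> a" "\<And>x. x \<in> S \<Longrightarrow> \<bar>g x\<bar> \<le> b"
    using assms(1,2) by (auto simp: bounded_iff)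
  then have "\<bar>k x\<bar> \<le> a + b" if "x \<in> S" for x
    using that assms(3)[of x] by (meson add_mono order_trans)
  then show ?thesis by (auto simp: bounded_iff)
qed

section \<open>Supports\<close>

locale Dp_map =
  fixes X :: "'a topology" and Y :: "'b topology"
    and DX :: "('a \<Rightarrow> real) set" and DY :: "('b \<Rightarrow> real) set"
    and T :: "('a \<Rightarrow> real) \<Rightarrow> ('b \<Rightarrow> real)"
  assumes metX: "metrizable_space X" and metY: "metrizable_space Y"
    and DX: "DX = C_space X \<or> DX = Cb_space X"
    and DY: "DY = C_space Y \<or> DY = Cb_space Y"
    and uc: "unif_continuous_Dp X DX Y DY T"
    and inv_bdd: "inversely_bounded X Y T"
begin

section \<open>Members of the function spaces and their convex combinations\<close>

lemma DX_cont: "f \<in> DX \<Longrightarrow> continuous_map X euclideanreal f"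
  using DX by (auto simp: C_space_def Cb_space_def)

lemma DX_ext: "f \<in> DX \<Longrightarrow> f \<in> extensional (topspace X)"
  using DX by (auto simp: C_space_def Cb_space_def)

lemma Cb_subset_DX: "Cb_space X \<subseteq> DX"
  using DX by (auto simp: Cb_space_def)

lemma T_DY: "f \<in> DX \<Longrightarrow> T f \<in> DY"
  using uc by (auto simp: unif_continuous_Dp_def)

lemma T_cont: "f \<in> DX \<Longrightarrow> continuous_map Y euclideanreal (T f)"
  using T_DY[of f] DY by (auto simp: C_space_def Cb_space_def)

text \<open>One criterion for both choices of \<open>DX\<close>: domination by two members passes
  boundedness on to \<open>k\<close>.\<close>

lemma DX_closed_if:
  assumes "f \<in> DX" "g \<in> DX" "continuous_map X euclideanreal k"
    "\<And>x. x \<in> topspace X \<Longrightarrow> \<bar>k x\<bar> \<le> \<bar>f x\<bar> + \<bar>g x\<bar>"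
  shows "restrict k (topspace X) \<in> DX"
proof -
  have "continuous_map X euclideanreal (restrict k (topspace X))"
    using assms(3) by (rule continuous_map_eq) auto
  then have C: "restrict k (topspace X) \<in> C_space X" by (simp add: C_space_def)
  have "restrict k (topspace X) \<in> Cb_space X" if "DX = Cb_space X"
    using that C assms(1,2,4) bounded_image_dominated[of f "topspace X" g k]
    by (auto simp: Cb_space_def)
  with C DX show ?thesis by auto
qed

text \<open>This is \<open>(1 - h) * f + h * g\<close>. With a Urysohn function \<open>h\<close> it
  replaces \<open>f\<close> by \<open>g\<close> at chosen points and keeps \<open>f\<close> away
  from them.\<close>

definition blend :: "('a \<Rightarrow> real) \<Rightarrow> ('a \<Rightarrow> real) \<Rightarrow> ('a \<Rightarrow> real) \<Rightarrow> 'a \<Rightarrow> real" where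
  "blend f g h = (\<lambda>x\<in>topspace X. f x + h x * (g x - f x))"

lemma blend_in_DX:
  assumes "f \<in> DX" "g \<in> DX" "continuous_map X euclideanreal h"
    "\<And>x. x \<in> topspace X \<Longrightarrow> h x \<in> {0..1}"
  shows "blend f g h \<in> DX"
  unfolding blend_def
proof (rule DX_closed_if[OF assms(1,2)])
  show "continuous_map X euclideanreal (\<lambda>x. f x + h x * (g x - f x))"
    using assms DX_cont by (intro continuous_intros) auto
  fix x assume "x \<in> topspace X"
  then have h: "0 \<le> h x" "h x \<le> 1" using assms(4) by auto
  have "f x + h x * (g x - f x) = (1 - h x) * f x + h x * g x" by (simp add: algebra_simps)
  also have "\<bar>\<dots>\<bar> \<le> \<bar>(1 - h x) * f x\<bar> + \<bar>h x * g x\<bar>" by (rule abs_triangle_ineq)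
  also have "\<dots> \<le> \<bar>f x\<bar> + \<bar>g x\<bar>"
    using h by (intro add_mono) (auto simp: abs_mult intro!: mult_left_le_one_le)
  finally show "\<bar>f x + h x * (g x - f x)\<bar> \<le> \<bar>f x\<bar> + \<bar>g x\<bar>" .
qed

lemma zero_fun_in: "zero_fun X \<in> DX" "zero_fun Y \<in> DY"
proof -
  have "zero_fun Z \<in> Cb_space Z" for Z :: "'c topology"
  proof -
    have "continuous_map Z euclideanreal (zero_fun Z)"
      by (rule continuous_map_eq[of _ _ "\<lambda>_. 0"]) (auto simp: zero_fun_def)
    then show ?thesis
      by (auto simp: Cb_space_def C_space_def zero_fun_def bounded_iff)
  qed
  then show "zero_fun X \<in> DX" "zero_fun Y \<in> DY"
    using DX DY by (auto simp: Cb_space_def)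
qed

section \<open>Uniform continuity through finitely many coordinates\<close>

text \<open>A basic neighbourhood of zero in the pointwise topology constrains only finitely many
  coordinates. These form \<open>K\<close>, and \<open>\<delta>\<close> is so small that
  \<open>(-\<delta>, \<delta>)\<close> meets all their constraints.\<close>

lemma uniformly_continuous_at_point:
  assumes y: "y \<in> topspace Y" and "e > 0"
  obtains K \<delta> where "finite K" "K \<subseteq> topspace X" "\<delta> > 0"
    "\<And>f g. \<lbrakk>f \<in> DX; g \<in> DX; \<forall>x\<in>K. \<bar>f x - g x\<bar> < \<delta>\<rbrakk> \<Longrightarrow> \<bar>T f y - T g y\<bar> < e"
proof -
  define P where "P = pointwise_topology Y DY"
  have "continuous_map P euclideanreal (\<lambda>u. u y)"
    unfolding P_def pointwise_topology_def
    using continuous_map_product_coordinates[OF y, of "\<lambda>_. euclideanreal"]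
    by (rule continuous_map_from_subtopology)
  then have "openin P {u \<in> topspace P. u y \<in> {-e<..<e}}"
    by (rule openin_continuous_map_preimage) simp
  moreover have "zero_fun Y \<in> {u \<in> topspace P. u y \<in> {-e<..<e}}"
    using zero_fun_in y \<open>e > 0\<close> by (auto simp: P_def pointwise_topology_def zero_fun_def)
  ultimately obtain V where V: "openin (pointwise_topology X DX) V" "zero_fun X \<in> V"
      "\<And>f g. \<lbrakk>f \<in> DX; g \<in> DX; diff_fun X f g \<in> V\<rbrakk> \<Longrightarrow> diff_fun Y (T f) (T g) y \<in> {-e<..<e}"
  proof -
    obtain V where "openin (pointwise_topology X DX) V" "zero_fun X \<in> V"
      "\<forall>f\<in>DX. \<forall>g\<in>DX. diff_fun X f g \<in> V \<longrightarrow>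
         diff_fun Y (T f) (T g) \<in> {u \<in> topspace P. u y \<in> {-e<..<e}}"
      using uc \<open>openin P _\<close> \<open>zero_fun Y \<in> _\<close> unfolding unif_continuous_Dp_def P_def by meson
    then show thesis by (intro that[of V]) blast+
  qed
  from V(1) obtain W where W: "openin (product_topology (\<lambda>_. euclideanreal) (topspace X)) W"
      "V = W \<inter> DX"
    by (auto simp: pointwise_topology_def openin_subtopology)
  then obtain S where S: "finite {i \<in> topspace X. S i \<noteq> UNIV}" "\<And>i. i \<in> topspace X \<Longrightarrow> open (S i)"
      "zero_fun X \<in> Pi\<^sub>E (topspace X) S" "Pi\<^sub>E (topspace X) S \<subseteq> W"
  proof -
    have "zero_fun X \<in> W" using V(2) W(2) by blast
    then obtain S where "finite {i \<in> topspace X. S i \<noteq> topspace euclideanreal}"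
        "\<forall>i\<in>topspace X. openin euclideanreal (S i)"
        "zero_fun X \<in> Pi\<^sub>E (topspace X) S" "Pi\<^sub>E (topspace X) S \<subseteq> W"
      using W(1) unfolding openin_product_topology_alt by meson
    then show thesis by (intro that[of S]) auto
  qed
  define K where "K = {i \<in> topspace X. S i \<noteq> UNIV}"
  have "\<exists>r>0. ball 0 r \<subseteq> S x" if "x \<in> topspace X" for x
  proof -
    have "0 \<in> S x" using S(3) that by (auto simp: zero_fun_def PiE_iff)
    with S(2)[OF that] show ?thesis by (auto simp: open_contains_ball)
  qed
  then obtain r where r: "\<And>x. x \<in> topspace X \<Longrightarrow> r x > 0 \<and> ball 0 (r x) \<subseteq> S x"
    by metis
  define \<delta> where "\<delta> = Min (insert 1 (r ` K))"
  show thesis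
  proof
    show K: "finite K" "K \<subseteq> topspace X" using S(1) by (auto simp: K_def)
    show "\<delta> > 0" using K r by (auto simp: \<delta>_def)
    fix f g assume fg: "f \<in> DX" "g \<in> DX" "\<forall>x\<in>K. \<bar>f x - g x\<bar> < \<delta>"
    have "f x - g x \<in> S x" if "x \<in> topspace X" for x
    proof (cases "x \<in> K")
      case True
      then have "\<delta> \<le> r x" using K by (auto simp: \<delta>_def)
      then have "f x - g x \<in> ball 0 (r x)" using fg(3) True by force
      then show ?thesis using r that by blast
    qed (use that in \<open>auto simp: K_def\<close>)
    then have "diff_fun X f g \<in> W"
      using S(4) by (auto simp: diff_fun_def)
    moreover have "diff_fun X f g \<in> DX"
      unfolding diff_fun_def using fg DX_cont
      by (intro DX_closed_if[OF fg(1,2)] continuous_intros) auto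
    ultimately have "diff_fun Y (T f) (T g) y \<in> {-e<..<e}"
      using V(3) fg W(2) by blast
    then show "\<bar>T f y - T g y\<bar> < e" using y by (auto simp: diff_fun_def)
  qed
qed

lemma T_tendsto:
  assumes "y \<in> topspace Y" "\<And>n. F n \<in> DX" "f \<in> DX"
    and lim: "\<And>x. x \<in> topspace X \<Longrightarrow> (\<lambda>n. F n x) \<longlonglongrightarrow> f x"
  shows "(\<lambda>n. T (F n) y) \<longlonglongrightarrow> T f y"
proof (rule tendstoI)
  fix e :: real assume "e > 0"
  obtain K \<delta> where K: "finite K" "K \<subseteq> topspace X" "\<delta> > 0"
    "\<And>f g. \<lbrakk>f \<in> DX; g \<in> DX; \<forall>x\<in>K. \<bar>f x - g x\<bar> < \<delta>\<rbrakk> \<Longrightarrow> \<bar>T f y - T g y\<bar> < e"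
    using uniformly_continuous_at_point[OF assms(1) \<open>e > 0\<close>] by blast
  have "\<forall>\<^sub>F n in sequentially. \<forall>x\<in>K. \<bar>F n x - f x\<bar> < \<delta>"
    using K(1,2,3) lim by (intro eventually_ball_finite) (auto simp: tendsto_iff dist_real_def subset_iff)
  then show "\<forall>\<^sub>F n in sequentially. dist (T (F n) y) (T f y) < e"
    by eventually_elim (use K(4) assms in \<open>auto simp: dist_real_def\<close>)
qed

section \<open>Finite supports with a bound\<close>

text \<open>The tolerance on \<open>K\<close> is strict, an open condition, while the bound
  \<open>p\<close> is not strict, so it survives limits both in \<open>y\<close> and in
  \<open>f\<close>.\<close>

definition supports :: "real \<Rightarrow> 'b \<Rightarrow> 'a set \<Rightarrow> bool" where
  "supports p y K \<longleftrightarrow> finite K \<and> K \<subseteq> topspace X \<and>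
     (\<forall>f\<in>DX. \<forall>g\<in>DX. (\<forall>x\<in>K. \<bar>f x - g x\<bar> < 1) \<longrightarrow> \<bar>T f y - T g y\<bar> \<le> p)"

lemma supportsD:
  "\<lbrakk>supports p y K; f \<in> DX; g \<in> DX; \<And>x. x \<in> K \<Longrightarrow> \<bar>f x - g x\<bar> < 1\<rbrakk> \<Longrightarrow> \<bar>T f y - T g y\<bar> \<le> p"
  by (auto simp: supports_def)

lemma supports_finite: "supports p y K \<Longrightarrow> finite K"
  and supports_subset: "supports p y K \<Longrightarrow> K \<subseteq> topspace X"
  by (auto simp: supports_def)

text \<open>Divide the segment from \<open>f\<close> to \<open>g\<close> into \<open>Suc N\<close>
  steps, each shorter than \<open>\<delta>\<close> on \<open>K\<close>. Each step moves the value at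
  \<open>y\<close> by less than \<open>1\<close>, which gives the bound
  \<open>Suc N\<close>.\<close>

lemma supports_exists:
  assumes "y \<in> topspace Y"
  obtains K and p :: nat where "supports p y K"
proof -
  obtain K \<delta> where K: "finite K" "K \<subseteq> topspace X" "\<delta> > 0"
    "\<And>f g. \<lbrakk>f \<in> DX; g \<in> DX; \<forall>x\<in>K. \<bar>f x - g x\<bar> < \<delta>\<rbrakk> \<Longrightarrow> \<bar>T f y - T g y\<bar> < 1"
    using uniformly_continuous_at_point[OF assms, of 1] by auto
  obtain N :: nat where N: "inverse (Suc N) < \<delta>"
    using K(3) reals_Archimedean by blast
  have "\<bar>T f y - T g y\<bar> \<le> Suc N" if fg: "f \<in> DX" "g \<in> DX" "\<forall>x\<in>K. \<bar>f x - g x\<bar> < 1" for f g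
  proof -
    define F where "F i = blend f g (\<lambda>_. real i / Suc N)" for i
    have F_in: "F i \<in> DX" if "i \<le> Suc N" for i
      unfolding F_def using that fg by (intro blend_in_DX) (auto simp: field_simps)
    have "\<bar>T (F 0) y - T (F i) y\<bar> \<le> i" if "i \<le> Suc N" for i
      using that
    proof (induction i)
      case (Suc i)
      have "\<bar>F i x - F (Suc i) x\<bar> < \<delta>" if "x \<in> K" for x
      proof -
        have "F (Suc i) x - F i x = inverse (Suc N) * (g x - f x)"
        proof -
          have "real (Suc i) / Suc N = real i / Suc N + inverse (Suc N)"
            by (simp add: add_divide_distrib inverse_eq_divide)
          then show ?thesis
            using that K(2) by (simp only: F_def blend_def restrict_apply subset_iff) (simp add: algebra_simps)
        qed
        then have "\<bar>F i x - F (Suc i) x\<bar> = inverse (Suc N) * \<bar>f x - g x\<bar>"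
          by (subst (1 2) abs_minus_commute) (simp add: abs_mult)
        also have "\<dots> \<le> inverse (Suc N) * 1"
          using fg(3) that by (intro mult_left_mono) (auto simp: less_imp_le)
        finally show ?thesis using N by simp
      qed
      then have "\<bar>T (F i) y - T (F (Suc i)) y\<bar> < 1"
        using Suc.prems by (intro K(4) F_in) auto
      then show ?case using Suc by auto
    qed simp
    moreover have "F 0 = f" "F (Suc N) = g"
      using fg DX_ext by (auto simp: F_def blend_def intro: extensionalityI[of _ "topspace X"])
    ultimately show ?thesis by force
  qed
  with K show thesis
    by (intro that[of "Suc N" K]) (auto simp: supports_def)
qed

section \<open>Inverse boundedness and points with a common support\<close>

lemma norm_bounded_sequence_lift:
  fixes g :: "nat \<Rightarrow> 'b \<Rightarrow> real"
  assumes "\<And>n. continuous_map Y euclideanreal (g n)"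
    and "\<And>n y. y \<in> topspace Y \<Longrightarrow> \<bar>g n y\<bar> \<le> B"
  obtains F M where "\<And>n. F n \<in> DX" "\<And>n x. x \<in> topspace X \<Longrightarrow> \<bar>F n x\<bar> \<le> M"
    "\<And>n y. y \<in> topspace Y \<Longrightarrow> T (F n) y = g n y"
proof -
  define h where "h n = restrict (g n) (topspace Y)" for n
  have "continuous_map Y euclideanreal (h n)" for n
    unfolding h_def using assms(1) by (rule continuous_map_eq) auto
  then have h: "h n \<in> Cb_space Y" for n
    using assms(2) by (auto simp: Cb_space_def C_space_def h_def bounded_iff)
  \<comment> \<open>The \<open>1\<close> makes the bound positive, as
    \<open>norm_bounded_seq\<close> demands.\<close>
  have "sup_norm Y (h n) \<le> max 1 B" for n
    unfolding sup_norm_def using assms(2) by (intro cSup_least) (auto simp: h_def le_max_iff_disj)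
  with h have "norm_bounded_seq Y h"
    unfolding norm_bounded_seq_def by (intro conjI exI[of _ "max 1 B"]) auto
  then obtain F where F: "norm_bounded_seq X F" "\<And>n. T (F n) = h n"
    using inv_bdd unfolding inversely_bounded_def by metis
  then obtain M where M: "\<And>n. F n \<in> Cb_space X" "\<And>n. sup_norm X (F n) \<le> M"
    unfolding norm_bounded_seq_def by blast
  have "\<bar>F n x\<bar> \<le> M" if "x \<in> topspace X" for n x
  proof -
    obtain b where "\<And>x. x \<in> topspace X \<Longrightarrow> \<bar>F n x\<bar> \<le> b"
      using M(1)[of n] by (auto simp: Cb_space_def bounded_iff)
    then have "bdd_above (insert 0 ((\<lambda>x. \<bar>F n x\<bar>) ` topspace X))"
      by (intro bdd_aboveI[of _ "max 0 b"]) (auto simp: le_max_iff_disj)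
    then have "\<bar>F n x\<bar> \<le> sup_norm X (F n)"
      unfolding sup_norm_def using that by (intro cSup_upper) auto
    then show ?thesis using M(2)[of n] by linarith
  qed
  moreover have "F n \<in> DX" for n using M(1) Cb_subset_DX by blast
  moreover have "T (F n) y = g n y" if "y \<in> topspace Y" for n y
    using F(2) that by (simp add: h_def)
  ultimately show thesis using that by blast
qed

text \<open>Infinitely many points \<open>y\<^sub>n\<close> with a common support \<open>K\<close> are impossible: functions on \<open>Y\<close>
  with \<open>g\<^sub>n = p + 1\<close> at \<open>y\<^sub>n\<close> and \<open>g\<^sub>n = 0\<close> at the earlier points have uniformly bounded preimages,
  and by the pigeonhole principle two of these preimages differ by less than \<open>1\<close> on \<open>K\<close>.\<close>

lemma finite_supported_points: "finite {y \<in> topspace Y. supports p y K}"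
proof (rule ccontr)
  assume "infinite {y \<in> topspace Y. supports p y K}"
  then obtain y :: "nat \<Rightarrow> 'b" where "inj y" and "range y \<subseteq> {y \<in> topspace Y. supports p y K}"
    using infinite_countable_subset by blast
  then have y: "\<And>n. y n \<in> topspace Y" "\<And>n. supports p (y n) K" by auto
  \<comment> \<open>The absolute value covers negative \<open>p\<close>: the interval
    \<open>{0..b}\<close> needs \<open>0 \<le> b\<close>, and the final contradiction needs
    \<open>p < b\<close>.\<close>
  define b where "b = \<bar>p\<bar> + 1"
  have "\<exists>g. continuous_map Y (top_of_set {0..b}) g \<and> g ` (y ` {..<n}) \<subseteq> {0} \<and> g ` {y n} \<subseteq> {b}" for n
  proof -
    have "closedin Y S" if "finite S" "S \<subseteq> topspace Y" for S
      using that metrizable_imp_t1_space[OF metY] by (simp add: t1_space_closedin_finite)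
    then have "closedin Y (y ` {..<n})" "closedin Y {y n}"
      using y(1) by blast+
    moreover have "disjnt (y ` {..<n}) {y n}"
      using \<open>inj y\<close> by (auto simp: disjnt_def inj_eq)
    ultimately show ?thesis
      using Urysohn_lemma[OF metrizable_imp_normal_space[OF metY], of "y ` {..<n}" "{y n}" 0 b]
      by (force simp: b_def)
  qed
  then obtain g where g: "\<And>n. continuous_map Y (top_of_set {0..b}) (g n)"
      "\<And>n. g n ` (y ` {..<n}) \<subseteq> {0}" "\<And>n. g n ` {y n} \<subseteq> {b}"
    by metis
  have g_cont: "continuous_map Y euclideanreal (g n)" and "g n \<in> topspace Y \<rightarrow> {0..b}" for n
    using g(1)[of n] by (auto simp: continuous_map_in_subtopology)
  then have g_bd: "\<bar>g n z\<bar> \<le> b" if "z \<in> topspace Y" for n z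
    using that by (force simp: Pi_iff)
  obtain F M where F: "\<And>n. F n \<in> DX" "\<And>n x. x \<in> topspace X \<Longrightarrow> \<bar>F n x\<bar> \<le> M"
    "\<And>n z. z \<in> topspace Y \<Longrightarrow> T (F n) z = g n z"
    using norm_bounded_sequence_lift[of g b] g_cont g_bd by blast
  have K: "finite K" "K \<subseteq> topspace X"
    using y(2) by (auto simp: supports_def)
  \<comment> \<open>Integer parts discretize the values: the common bound \<open>M\<close> leaves
    finitely many patterns on \<open>K\<close>, and equal patterns force differences below
    \<open>1\<close>.\<close>
  define \<phi> where "\<phi> n = (\<lambda>x\<in>K. \<lfloor>F n x\<rfloor>)" for n
  have "range \<phi> \<subseteq> K \<rightarrow>\<^sub>E {\<lfloor>-M\<rfloor>..\<lfloor>M\<rfloor>}"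
  proof clarify
    fix n
    have "\<lfloor>F n x\<rfloor> \<in> {\<lfloor>-M\<rfloor>..\<lfloor>M\<rfloor>}" if "x \<in> K" for x
      using F(2)[of x n] K(2) that by (auto intro!: floor_mono)
    then show "\<phi> n \<in> K \<rightarrow>\<^sub>E {\<lfloor>-M\<rfloor>..\<lfloor>M\<rfloor>}" by (auto simp: \<phi>_def)
  qed
  then have "finite (range \<phi>)"
    using K(1) by (rule finite_subset[OF _ finite_PiE]) auto
  then have "\<not> inj \<phi>"
    using finite_imageD infinite_UNIV_nat by blast
  then obtain m n where "m < n" "\<phi> m = \<phi> n"
    by (metis injI linorder_neqE_nat)
  have "\<bar>F m x - F n x\<bar> < 1" if "x \<in> K" for x
  proof -
    have "\<lfloor>F m x\<rfloor> = \<lfloor>F n x\<rfloor>"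
      using fun_cong[OF \<open>\<phi> m = \<phi> n\<close>, of x] that by (simp add: \<phi>_def)
    then show ?thesis by linarith
  qed
  then have "\<bar>T (F m) (y m) - T (F n) (y m)\<bar> \<le> p"
    using supportsD y(2) F(1) by blast
  moreover have "g m (y m) = b" "g n (y m) = 0"
    using g(2)[of n] g(3)[of m] \<open>m < n\<close> by (auto simp: image_subset_iff)
  then have "T (F m) (y m) = b" "T (F n) (y m) = 0"
    using F(3) y(1) by simp_all
  ultimately show False by (simp add: b_def)
qed

section \<open>Removal of redundant support points\<close>

text \<open>Lower semicontinuity of minimal supports: a support point that the supports of nearby
  points avoid is redundant, up to doubling the constant.\<close>

lemma supports_remove:
  assumes sup: "supports p y K" and "openin X U" "x \<in> U"
    and cl: "y \<in> Y closure_of {z. \<exists>K'. supports p z K' \<and> K' \<inter> U = {}}"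
  shows "supports (2 * p) y (K - {x})"
proof -
  \<comment> \<open>Changing a function within \<open>U\<close> alone moves the value by at most
    \<open>p\<close> at points with a support off \<open>U\<close>. This is a closed condition on
    the point, so it holds at \<open>y\<close> too.\<close>
  have far: "\<bar>T f y - T g y\<bar> \<le> p"
    if "f \<in> DX" "g \<in> DX" and eq: "\<And>x. x \<in> topspace X - U \<Longrightarrow> f x = g x" for f g
  proof -
    have "closedin Y {z \<in> topspace Y. \<bar>T f z - T g z\<bar> \<in> {..p}}"
      using that T_cont by (intro closedin_continuous_map_preimage[where Y=euclideanreal] continuous_intros) auto
    moreover have "topspace Y \<inter> {z. \<exists>K'. supports p z K' \<and> K' \<inter> U = {}}
        \<subseteq> {z \<in> topspace Y. \<bar>T f z - T g z\<bar> \<in> {..p}}"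
    proof
      fix z assume "z \<in> topspace Y \<inter> {z. \<exists>K'. supports p z K' \<and> K' \<inter> U = {}}"
      then obtain K' where z: "z \<in> topspace Y" and K': "supports p z K'" "K' \<inter> U = {}"
        by blast
      have "f x = g x" if "x \<in> K'" for x
        using eq[of x] K' supports_subset that by blast
      then have "\<bar>T f z - T g z\<bar> \<le> p"
        using that K'(1) by (intro supportsD) auto
      with z show "z \<in> {z \<in> topspace Y. \<bar>T f z - T g z\<bar> \<in> {..p}}" by simp
    qed
    ultimately have "Y closure_of (topspace Y \<inter> {z. \<exists>K'. supports p z K' \<and> K' \<inter> U = {}})
        \<subseteq> {z \<in> topspace Y. \<bar>T f z - T g z\<bar> \<in> {..p}}"
      by (rule closure_of_minimal[rotated])
    then show ?thesis
      using cl unfolding closure_of_restrict[of Y "{z. _ z}"] by blast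
  qed
  have "\<bar>T f y - T g y\<bar> \<le> 2 * p"
    if fg: "f \<in> DX" "g \<in> DX" "\<And>z. z \<in> K - {x} \<Longrightarrow> \<bar>f z - g z\<bar> < 1" for f g
  proof -
    have xX: "x \<in> topspace X" using assms(2,3) openin_subset by blast
    have "closedin X (topspace X - U)" "closedin X {x}"
      using xX assms(2) metrizable_imp_t1_space[OF metX] by (auto simp: t1_space_closedin_finite)
    moreover have "disjnt (topspace X - U) {x}"
      using assms(3) by auto
    ultimately obtain h where h: "continuous_map X (top_of_set {0..1::real}) h"
        "h ` (topspace X - U) \<subseteq> {0}" "h ` {x} \<subseteq> {1}"
      using Urysohn_lemma[OF metrizable_imp_normal_space[OF metX], of "topspace X - U" "{x}" 0 1]
      by force
    have h01: "h z \<in> {0..1}" if "z \<in> topspace X" for z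
      using h(1) that by (auto simp: continuous_map_in_subtopology Pi_iff)
    \<comment> \<open>\<open>f'\<close> is \<open>f\<close> off \<open>U\<close> and
      \<open>g\<close> at \<open>x\<close>. Passing from \<open>f\<close> to \<open>f'\<close> costs
      \<open>p\<close> by \<open>far\<close>, and from \<open>f'\<close> to \<open>g\<close> another
      \<open>p\<close> by the support \<open>K\<close>.\<close>
    define f' where "f' = blend f g h"
    have f': "f' \<in> DX"
      unfolding f'_def using h(1) h01 fg
      by (intro blend_in_DX) (auto simp: continuous_map_in_subtopology)
    have "\<bar>T f y - T f' y\<bar> \<le> p"
      using fg f' h(2) by (intro far) (auto simp: f'_def blend_def)
    moreover have "\<bar>T f' y - T g y\<bar> \<le> p"
    proof (rule supportsD[OF sup f' fg(2)])
      fix z assume z: "z \<in> K"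
      then have zX: "z \<in> topspace X" using sup supports_subset by blast
      have "f' z - g z = (1 - h z) * (f z - g z)"
        using zX by (simp add: f'_def blend_def algebra_simps)
      then have eq: "\<bar>f' z - g z\<bar> = (1 - h z) * \<bar>f z - g z\<bar>"
        using h01[OF zX] by (simp add: abs_mult)
      show "\<bar>f' z - g z\<bar> < 1"
      proof (cases "z = x")
        case True
        then show ?thesis using eq h(3) by auto
      next
        case False
        have "(1 - h z) * \<bar>f z - g z\<bar> \<le> \<bar>f z - g z\<bar>"
          using h01[OF zX] by (intro mult_left_le_one_le) auto
        also have "\<dots> < 1" using fg(3) False z by blast
        finally show ?thesis using eq by simp
      qed
    qed
    ultimately show ?thesis by linarith
  qed
  then show ?thesis
    using sup by (auto simp: supports_def)
qed

section \<open>Closedness of the sets of points with small support\<close>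

text \<open>The strict \<open>card K < k\<close> serves both needs: at most \<open>q\<close> points
  for \<open>k = Suc q\<close>, and fewer than \<open>q\<close> points for
  \<open>k = q\<close>.\<close>

definition small_support :: "real \<Rightarrow> nat \<Rightarrow> 'b set" where
  "small_support p k = {y \<in> topspace Y. \<exists>K. supports p y K \<and> card K < k}"

lemma closedin_small_support: "closedin Y (small_support p k)"
proof -
  obtain MY dY where MY: "Metric_space MY dY" and Y: "Y = Metric_space.mtopology MY dY"
    using metY by (auto simp: metrizable_space_def)
  obtain M d where M: "Metric_space M d" and X: "X = Metric_space.mtopology M d"
    using metX by (auto simp: metrizable_space_def)
  interpret B: Metric_space MY dY by fact
  interpret Metric_space M d by fact
  have XM: "topspace X = M" and YM: "topspace Y = MY" by (simp_all add: X Y)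
  \<comment> \<open>Along a subsequence with a maximal set \<open>L\<close> of limits of support points, the remaining support
    points run away from every point of \<open>X\<close>; then \<open>L\<close> supports \<open>y\<close>, since \<open>f\<close> can be made equal to \<open>g\<close>
    at those points by changes \<open>F N\<close> that tend to \<open>f\<close> pointwise.\<close>
  have "y \<in> small_support p k"
    if \<sigma>: "range \<sigma> \<subseteq> small_support p k" and lim: "limitin Y \<sigma> y sequentially" for \<sigma> y
  proof -
    have "\<exists>K. supports p (\<sigma> n) K \<and> card K < k" for n
      using \<sigma> by (auto simp: small_support_def)
    then obtain K where K: "\<And>n. supports p (\<sigma> n) (K n)" "\<And>n. card (K n) < k"
      by metis
    have KM: "K n \<subseteq> M" "finite (K n)" for n
      using K(1)[of n] XM by (auto simp: supports_def)
    have y: "y \<in> topspace Y" using lim by (simp add: limitin_def)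
    define clus where "clus = (\<lambda>(r :: nat \<Rightarrow> nat, L). strict_mono r \<and> finite L \<and> L \<subseteq> M \<and>
      (\<forall>x\<in>L. \<forall>e>0. \<forall>\<^sub>F n in sequentially. \<exists>z\<in>K (r n). d x z < e))"
    \<comment> \<open>Separated points of \<open>L\<close> pick distinct nearby members of one
      \<open>K (r n)\<close>. The bound makes a maximal \<open>L\<close> exist and at the end shows
      that \<open>L\<close> is small enough.\<close>
    have clus_card: "card L < k" if "clus (r, L)" for r L
    proof -
      have L: "finite L" "L \<subseteq> M" "\<And>x e. x \<in> L \<Longrightarrow> e > 0 \<Longrightarrow> \<forall>\<^sub>F n in sequentially. \<exists>z\<in>K (r n). d x z < e"
        using that by (auto simp: clus_def)
      obtain e where e: "e > 0" "\<And>x x' z. \<lbrakk>x \<in> L; x' \<in> L; z \<in> M; d x z < e; d x' z < e\<rbrakk> \<Longrightarrow> x = x'"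
        using finite_separated[OF L(1,2)] by blast
      have "\<forall>\<^sub>F n in sequentially. \<forall>x\<in>L. \<exists>z\<in>K (r n). d x z < e"
        using L e(1) by (intro eventually_ball_finite) auto
      then obtain n where "\<forall>x\<in>L. \<exists>z\<in>K (r n). d x z < e"
        using eventually_happens'[OF sequentially_bot] by blast
      then obtain \<zeta> where \<zeta>: "\<And>x. x \<in> L \<Longrightarrow> \<zeta> x \<in> K (r n) \<and> d x (\<zeta> x) < e" by metis
      have "inj_on \<zeta> L"
      proof (rule inj_onI)
        fix x x' assume "x \<in> L" "x' \<in> L" "\<zeta> x = \<zeta> x'"
        then show "x = x'" using \<zeta>[of x] \<zeta>[of x'] KM e(2)[of x x' "\<zeta> x"] by auto
      qed
      then have "card L \<le> card (K (r n))"
        using \<zeta> KM by (intro card_inj_on_le) auto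
      then show ?thesis using K(2)[of "r n"] by linarith
    qed
    have "clus (id, {})" by (auto simp: clus_def strict_mono_id)
    then have "\<exists>q. clus q \<and> (\<forall>q'. clus q' \<longrightarrow> card (snd q') \<le> card (snd q))"
      using clus_card by (intro ex_has_greatest_nat[where b=k]) (auto simp: less_imp_le)
    then obtain r L where rL: "clus (r, L)" and max: "\<And>r' L'. clus (r', L') \<Longrightarrow> card L' \<le> card L"
      by fastforce
    have r: "strict_mono r" and L: "finite L" "L \<subseteq> M"
      and L_near: "\<And>x e. x \<in> L \<Longrightarrow> e > 0 \<Longrightarrow> \<forall>\<^sub>F n in sequentially. \<exists>z\<in>K (r n). d x z < e"
      using rL by (auto simp: clus_def)
    \<comment> \<open>Otherwise a further subsequence has support points converging to
      \<open>x\<close>, and \<open>insert x L\<close> contradicts maximality.\<close>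
    have away: "\<exists>\<delta>>0. \<forall>\<^sub>F n in sequentially. \<forall>z\<in>K (r n). \<delta> \<le> d x z" if x: "x \<in> M" "x \<notin> L" for x
    proof (rule ccontr)
      assume neg: "\<not> ?thesis"
      have "\<exists>n>N. \<exists>z\<in>K (r n). d x z < e" if "e > 0" for e N
      proof -
        have "\<not> (\<forall>\<^sub>F n in sequentially. \<forall>z\<in>K (r n). e \<le> d x z)"
          using neg that by blast
        then obtain n where "n \<ge> Suc N" "\<not> (\<forall>z\<in>K (r n). e \<le> d x z)"
          unfolding eventually_sequentially by blast
        then show ?thesis by (intro exI[of _ n]) (auto simp: not_le)
      qed
      then have step: "\<exists>n>N. \<exists>z\<in>K (r n). d x z < inverse (Suc m)" for N m by simp
      have "\<exists>s. \<forall>m. (\<exists>z\<in>K (r (s m)). d x z < inverse (Suc m)) \<and> s m < s (Suc m)"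
      proof (rule dependent_nat_choice)
        show "\<exists>n. \<exists>z\<in>K (r n). d x z < inverse (Suc 0)"
          using step[of 0 0] by (elim exE conjE) (rule exI)
        show "\<exists>n'. (\<exists>z\<in>K (r n'). d x z < inverse (Suc (Suc m))) \<and> n < n'" for n m
          using step[of n "Suc m"] by (elim exE conjE) (intro exI conjI)
      qed
      then obtain s where s: "\<And>m. \<exists>z\<in>K (r (s m)). d x z < inverse (Suc m)" "strict_mono s"
        by (auto simp: strict_mono_Suc_iff)
      have "clus (r \<circ> s, insert x L)"
        unfolding clus_def prod.case
      proof (intro conjI ballI allI impI)
        show "strict_mono (r \<circ> s)" using r s(2) by (simp add: strict_mono_o)
        fix x' e assume x': "x' \<in> insert x L" and "(e::real) > 0"
        show "\<forall>\<^sub>F n in sequentially. \<exists>z\<in>K ((r \<circ> s) n). d x' z < e"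
        proof (cases "x' = x")
          case True
          have "\<forall>\<^sub>F n in sequentially. inverse (real (Suc n)) < e"
            using LIMSEQ_inverse_real_of_nat \<open>e > 0\<close> by (rule order_tendstoD)
          then show ?thesis
            by eventually_elim (use s(1) True in \<open>force intro: less_trans\<close>)
        next
          case False
          then show ?thesis
            using eventually_subseq[OF s(2) L_near[of x' e]] x' \<open>e > 0\<close> by simp
        qed
      qed (use L x in auto)
      then have "card (insert x L) \<le> card L" by (rule max)
      then show False using x L by simp
    qed
    have "supports p y L"
      unfolding supports_def
    proof (intro conjI ballI impI)
      show "finite L" "L \<subseteq> topspace X" using L XM by auto
      fix f g assume fg: "f \<in> DX" "g \<in> DX" and near: "\<forall>x\<in>L. \<bar>f x - g x\<bar> < 1"
      define G where "G = {x \<in> topspace X. \<bar>f x - g x\<bar> \<in> {..<1}}"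
      have "openin X G"
        unfolding G_def using fg DX_cont
        by (intro openin_continuous_map_preimage[where Y=euclideanreal] continuous_intros) auto
      \<comment> \<open>\<open>P N\<close> collects the support points from stage \<open>N\<close>
        on where \<open>f\<close> and \<open>g\<close> differ by at least \<open>1\<close>. Below,
        \<open>F N\<close> equals \<open>g\<close> on them and \<open>f\<close> outside their
        \<open>1/(N+1)\<close>-neighbourhood \<open>O' N\<close>.\<close>
      define P where "P N = (\<Union>n\<in>{N..}. K (r n)) - G" for N
      define O' where "O' N = (\<Union>z\<in>P N. mball z (inverse (Suc N)))" for N
      have PM: "P N \<subseteq> M" for N using KM by (auto simp: P_def)
      have "\<exists>h. continuous_map X (top_of_set {0..1::real}) h \<and>
          h ` (topspace X - O' N) \<subseteq> {0} \<and> h ` (X closure_of (P N)) \<subseteq> {1}" for N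
      proof -
        have "closedin X (topspace X - O' N)"
          by (auto simp: O'_def X)
        moreover have "disjnt (topspace X - O' N) (X closure_of (P N))"
        proof -
          \<comment> \<open>All balls in \<open>O' N\<close> have the same radius, so they absorb
            the closure.\<close>
          have "X closure_of (P N) \<subseteq> O' N"
            unfolding X metric_closure_of O'_def
            by (force simp: commute)
          then show ?thesis by (auto simp: disjnt_def)
        qed
        ultimately show ?thesis
          using Urysohn_lemma[OF metrizable_imp_normal_space[OF metX],
              of "topspace X - O' N" "X closure_of (P N)" 0 1] by force
      qed
      then obtain h where h: "\<And>N. continuous_map X (top_of_set {0..1::real}) (h N)"
          "\<And>N. h N ` (topspace X - O' N) \<subseteq> {0}" "\<And>N. h N ` (X closure_of (P N)) \<subseteq> {1}"
        by metis
      have h01: "h N z \<in> {0..1}" if "z \<in> topspace X" for z N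
        using h(1) that by (auto simp: continuous_map_in_subtopology Pi_iff)
      have hP: "h N z = 1" if "z \<in> P N" for z N
        using h(3)[of N] closure_of_subset[of "P N" X] PM XM that by auto
      define F where "F N = blend f g (h N)" for N
      have F: "F N \<in> DX" for N
        unfolding F_def using h(1) h01 fg
        by (intro blend_in_DX) (auto simp: continuous_map_in_subtopology)
      \<comment> \<open>\<open>F N\<close> is within \<open>1\<close> of \<open>g\<close> on
        \<open>K (r n)\<close> for all \<open>n \<ge> N\<close>; the resulting bound at
        \<open>\<sigma> (r n)\<close> passes to the limit \<open>y\<close>.\<close>
      have bound: "\<bar>T (F N) y - T g y\<bar> \<le> p" for N
      proof -
        have "\<bar>T (F N) (\<sigma> (r n)) - T g (\<sigma> (r n))\<bar> \<le> p" if "n \<ge> N" for n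
        proof (rule supportsD[OF K(1) F fg(2)])
          fix z assume z: "z \<in> K (r n)"
          then have zX: "z \<in> topspace X" using KM XM by blast
          have "F N z - g z = (1 - h N z) * (f z - g z)"
            using zX by (simp add: F_def blend_def algebra_simps)
          then have eq: "\<bar>F N z - g z\<bar> = (1 - h N z) * \<bar>f z - g z\<bar>"
            using h01[OF zX] by (simp add: abs_mult)
          show "\<bar>F N z - g z\<bar> < 1"
          proof (cases "z \<in> G")
            case False
            then have "z \<in> P N" using z that by (auto simp: P_def)
            then show ?thesis using eq hP by auto
          next
            case True
            have "(1 - h N z) * \<bar>f z - g z\<bar> \<le> \<bar>f z - g z\<bar>"
              using h01[OF zX] by (intro mult_left_le_one_le) auto
            also have "\<dots> < 1" using True by (simp add: G_def)
            finally show ?thesis using eq by simp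
          qed
        qed
        then have ev: "\<forall>\<^sub>F n in sequentially. \<bar>T (F N) (\<sigma> (r n)) - T g (\<sigma> (r n))\<bar> \<le> p"
          by (rule eventually_sequentiallyI)
        have lim_r: "limitin Y (\<sigma> \<circ> r) y sequentially"
          using lim r by (rule limitin_subsequence[rotated])
        have "continuous_map Y euclideanreal (\<lambda>z. \<bar>T (F N) z - T g z\<bar>)"
          using T_cont F fg by (intro continuous_intros) auto
        from continuous_map_limit[OF this lim_r] have "(\<lambda>n. \<bar>T (F N) (\<sigma> (r n)) - T g (\<sigma> (r n))\<bar>) \<longlonglongrightarrow> \<bar>T (F N) y - T g y\<bar>"
          by (simp add: o_def)
        then show ?thesis using ev sequentially_bot by (rule tendsto_upperbound)
      qed
      have "(\<lambda>N. T (F N) y) \<longlonglongrightarrow> T f y"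
      proof (rule T_tendsto[OF y F fg(1)])
        fix x assume x: "x \<in> topspace X"
        \<comment> \<open>If \<open>x\<close> is in \<open>G\<close>, the sets \<open>P N\<close>
          avoid a ball about it because \<open>G\<close> is open; otherwise \<open>x\<close> is
          outside \<open>L\<close> and \<open>away\<close> applies. Once \<open>1/(N+1)\<close> is
          smaller than the distance, \<open>F N x = f x\<close>.\<close>
        have "\<exists>\<delta>>0. \<forall>\<^sub>F N in sequentially. \<forall>z\<in>P N. \<delta> \<le> d x z"
        proof (cases "x \<in> G")
          case True
          then obtain \<delta> where "\<delta> > 0" "mball x \<delta> \<subseteq> G"
            using \<open>openin X G\<close> by (auto simp: X openin_mtopology)
          have "\<delta> \<le> d x z" if "z \<in> P N" for z N
          proof -
            have "z \<in> M" "z \<notin> mball x \<delta>"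
              using that PM \<open>mball x \<delta> \<subseteq> G\<close> by (auto simp: P_def)
            then show ?thesis using x XM by (simp add: not_less)
          qed
          with \<open>\<delta> > 0\<close> show ?thesis by auto
        next
          case False
          then have "x \<notin> L" using near x by (auto simp: G_def)
          then obtain \<delta> where \<delta>: "\<delta> > 0" "\<forall>\<^sub>F n in sequentially. \<forall>z\<in>K (r n). \<delta> \<le> d x z"
            using away x XM by blast
          then obtain N0 where N0: "\<And>n z. n \<ge> N0 \<Longrightarrow> z \<in> K (r n) \<Longrightarrow> \<delta> \<le> d x z"
            by (auto simp: eventually_sequentially)
          have "\<forall>z\<in>P N. \<delta> \<le> d x z" if "N \<ge> N0" for N
            using N0 that unfolding P_def by (meson DiffD1 UN_E atLeast_iff order_trans)
          then show ?thesis using \<delta>(1) by (auto simp: eventually_sequentially)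
        qed
        then obtain \<delta> where \<delta>: "\<delta> > 0" "\<forall>\<^sub>F N in sequentially. \<forall>z\<in>P N. \<delta> \<le> d x z"
          by blast
        have "\<forall>\<^sub>F n in sequentially. inverse (real (Suc n)) < \<delta>"
          using LIMSEQ_inverse_real_of_nat \<delta>(1) by (rule order_tendstoD)
        with \<delta>(2) have "\<forall>\<^sub>F N in sequentially. F N x = f x"
        proof eventually_elim
          case (elim N)
          have "x \<notin> O' N"
          proof
            assume "x \<in> O' N"
            then obtain z where "z \<in> P N" "d z x < inverse (Suc N)" by (auto simp: O'_def)
            with elim show False using commute[of x z] by fastforce
          qed
          then have "h N x = 0" using h(2)[of N] x by blast
          then show ?case using x by (simp add: F_def blend_def)
        qed
        then show "(\<lambda>N. F N x) \<longlonglongrightarrow> f x" by (rule tendsto_eventually)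
      qed
      then have "(\<lambda>N. \<bar>T (F N) y - T g y\<bar>) \<longlonglongrightarrow> \<bar>T f y - T g y\<bar>"
        by (intro tendsto_intros)
      then show "\<bar>T f y - T g y\<bar> \<le> p"
        by (rule tendsto_upperbound) (auto simp: bound)
    qed
    with clus_card[OF rL] y show ?thesis by (auto simp: small_support_def)
  qed
  moreover have "small_support p k \<subseteq> MY" using YM by (auto simp: small_support_def)
  ultimately show ?thesis
    unfolding Y B.metric_closedin_iff_sequentially_closed by (auto simp: Y)
qed

section \<open>Pieces of \<open>Y\<close> with minimal supports\<close>

text \<open>The factor \<open>2\<close> matches the loss in \<open>supports_remove\<close>: no point
  of a support of bound \<open>p\<close> with at most \<open>q\<close> elements can be redundant in
  that sense.\<close>

definition exact_support :: "nat \<Rightarrow> nat \<Rightarrow> 'b set" where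
  "exact_support p q = small_support p (Suc q) - small_support (2 * real p) q"

lemma exact_supportE:
  assumes "y \<in> exact_support p q"
  obtains K where "y \<in> topspace Y" "supports p y K" "card K \<le> q"
    "\<And>K'. supports (2 * real p) y K' \<Longrightarrow> q \<le> card K'"
  using assms by (auto simp: exact_support_def small_support_def less_Suc_eq_le not_less)

text \<open>Take \<open>q\<close> least among the sizes of supports of \<open>y\<close> over all
  natural bounds, and \<open>p\<close> a bound attaining it. Natural bounds keep the cover countable
  and include \<open>2 * p\<close>.\<close>

lemma exact_support_cover:
  assumes "y \<in> topspace Y"
  obtains p q where "y \<in> exact_support p q"
proof -
  define R where "R q \<longleftrightarrow> (\<exists>p::nat. \<exists>K. supports p y K \<and> card K = q)" for q
  obtain K0 and p0 :: nat where "supports p0 y K0"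
    using supports_exists[OF assms] by blast
  then have "R (card K0)" by (auto simp: R_def)
  then have "R (Least R)" by (rule LeastI)
  then obtain p :: nat and K where K: "supports p y K" "card K = Least R"
    by (auto simp: R_def)
  have "Least R \<le> card K'" if "supports (2 * real p) y K'" for K'
  proof (rule Least_le)
    have "supports (real (2 * p)) y K'" using that by simp
    then show "R (card K')" unfolding R_def by blast
  qed
  then have "y \<notin> small_support (2 * real p) (Least R)"
    by (auto simp: small_support_def not_less[symmetric])
  moreover have "y \<in> small_support p (Suc (Least R))"
    using K assms by (auto simp: small_support_def)
  ultimately show thesis using that by (auto simp: exact_support_def)
qed

text \<open>The small sets around the points of a minimal support each meet every nearby support, and
  by counting they exhaust it. This gives upper semicontinuity of the support.\<close>

lemma supports_upper_semicontinuous: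
  assumes y: "y \<in> exact_support p q" and K: "supports p y K" "card K \<le> q"
    and G: "openin X G" "K \<subseteq> G"
  obtains W where "openin Y W" "y \<in> W"
    "\<And>z K'. \<lbrakk>z \<in> W; supports p z K'; card K' \<le> q\<rbrakk> \<Longrightarrow> K' \<subseteq> G"
proof -
  obtain M d where M: "Metric_space M d" and X: "X = Metric_space.mtopology M d"
    using metX by (auto simp: metrizable_space_def)
  interpret Metric_space M d by fact
  have XM: "topspace X = M" by (simp add: X)
  have yY: "y \<in> topspace Y" and min: "\<And>K'. supports (2 * real p) y K' \<Longrightarrow> q \<le> card K'"
    using exact_supportE[OF y] by blast+
  have Kf: "finite K" "K \<subseteq> M"
    using K(1) XM by (auto simp: supports_def)
  \<comment> \<open>The separation makes the balls about the points of \<open>K\<close> disjoint, so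
    support points found in different balls are distinct.\<close>
  obtain e where e: "e > 0" "\<And>x x' z. \<lbrakk>x \<in> K; x' \<in> K; z \<in> M; d x z < e; d x' z < e\<rbrakk> \<Longrightarrow> x = x'"
    using finite_separated[OF Kf] by blast
  define U where "U x = mball x e \<inter> G" for x
  have U: "openin X (U x)" for x
    unfolding U_def using G(1) by (auto simp: X)
  have xU: "x \<in> U x" if "x \<in> K" for x
    using that e(1) Kf G(2) by (auto simp: U_def)
  define B where "B x = {z. \<exists>K'. supports p z K' \<and> K' \<inter> U x = {}}" for x
  define W where "W = topspace Y - (\<Union>x\<in>K. Y closure_of (B x))"
  \<comment> \<open>Otherwise \<open>K - {x}\<close> would support \<open>y\<close> with bound
    \<open>2p\<close> and fewer than \<open>q\<close> points.\<close>
  have "y \<notin> Y closure_of (B x)" if x: "x \<in> K" for x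
  proof
    assume "y \<in> Y closure_of (B x)"
    then have "supports (2 * real p) y (K - {x})"
      unfolding B_def by (rule supports_remove[OF K(1) U xU[OF x]])
    then have "q \<le> card (K - {x})" by (rule min)
    also have "\<dots> < card K" using Kf(1) x by (intro psubset_card_mono) auto
    finally show False using K(2) by simp
  qed
  then have "y \<in> W" using yY by (auto simp: W_def)
  moreover have "openin Y W"
    unfolding W_def using Kf(1) by (intro openin_diff closedin_Union) auto
  moreover have "K' \<subseteq> G" if z: "z \<in> W" and K': "supports p z K'" "card K' \<le> q" for z K'
  proof -
    have "K' \<inter> U x \<noteq> {}" if x: "x \<in> K" for x
    proof
      assume "K' \<inter> U x = {}"
      with K'(1) have "z \<in> B x" by (auto simp: B_def)
      then have "z \<in> Y closure_of (B x)"
        using z by (intro closure_of_subset_Int[THEN subsetD]) (auto simp: W_def)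
      with z x show False by (auto simp: W_def)
    qed
    then have "\<exists>w. w \<in> K' \<and> w \<in> U x" if "x \<in> K" for x using that by blast
    then obtain w where w: "\<And>x. x \<in> K \<Longrightarrow> w x \<in> K' \<and> w x \<in> U x" by metis
    have "inj_on w K"
    proof (rule inj_onI)
      fix x x' assume x: "x \<in> K" "x' \<in> K" "w x = w x'"
      then have "w x \<in> mball x e" "w x \<in> mball x' e" using w[of x] w[of x'] by (auto simp: U_def)
      then show "x = x'" using e(2)[OF x(1,2), of "w x"] by auto
    qed
    then have "card (w ` K) = card K" by (rule card_image)
    \<comment> \<open>\<open>K\<close> is also a support of bound \<open>2p\<close>, so minimality
      applies to it; then \<open>w\<close> selects at least \<open>q\<close> points of
      \<open>K'\<close>, hence all of them.\<close>
    moreover have "q \<le> card K"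
    proof (rule min)
      show "supports (2 * real p) y K"
        using K(1) unfolding supports_def by (meson order_trans mult_le_cancel_right1 of_nat_0_le_iff one_le_numeral not_le)
    qed
    moreover have "finite K'" "w ` K \<subseteq> K'" using K'(1) supports_finite w by auto
    ultimately have "w ` K = K'" using K'(2) by (intro card_seteq) auto
    then show ?thesis using w by (auto simp: U_def)
  qed
  ultimately show thesis using that by blast
qed

section \<open>Transfer of the \<open>G\<^sub>\<delta>\<close> property for countable sets\<close>

text \<open>Upper semicontinuity makes the condition of having a support inside an open set open in
  the piece. A countable set has countably many finite subsets, each supporting finitely many
  points, so the \<open>G\<^sub>\<delta>\<close> set obtained is countable.\<close>

lemma gdelta_in_countable_Int_exact_support:
  assumes X_gd: "\<And>D. countable D \<Longrightarrow> D \<subseteq> topspace X \<Longrightarrow> gdelta_in X D"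
    and C: "countable C" "C \<subseteq> exact_support p q"
  shows "gdelta_in (subtopology Y (exact_support p q)) C"
proof -
  define S where "S = subtopology Y (exact_support p q)"
  have sub_Y: "exact_support p q \<subseteq> topspace Y"
    by (auto simp: exact_support_def small_support_def)
  have topS: "topspace S = exact_support p q"
    using sub_Y by (auto simp: S_def)
  have "\<exists>K. supports p y K \<and> card K \<le> q" if "y \<in> C" for y
    using C(2) that exact_supportE by blast
  then obtain K where K: "\<And>y. y \<in> C \<Longrightarrow> supports p y (K y)" "\<And>y. y \<in> C \<Longrightarrow> card (K y) \<le> q"
    by metis
  define D where "D = (\<Union>y\<in>C. K y)"
  have "countable (K y)" "K y \<subseteq> topspace X" if "y \<in> C" for y
    using K(1)[OF that] by (simp_all add: supports_def countable_finite)
  then have D: "countable D" "D \<subseteq> topspace X"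
    unfolding D_def using C(1) by (simp_all add: UN_least)
  obtain G where G_open: "\<forall>n. openin X (G n)" and "\<forall>n. G (Suc n) \<subseteq> G n" and G_D: "\<Inter>(range G) = D"
    using X_gd[OF D] unfolding gdelta_in_descending by (elim exE conjE)
  have G: "openin X (G n)" for n using G_open by (rule spec)
  define O' where "O' n = {y \<in> exact_support p q. \<exists>K. supports p y K \<and> card K \<le> q \<and> K \<subseteq> G n}" for n
  have "openin S (O' n)" for n
  proof (subst openin_subopen, intro ballI)
    fix y assume "y \<in> O' n"
    then obtain K where y: "y \<in> exact_support p q" and K: "supports p y K" "card K \<le> q" "K \<subseteq> G n"
      by (auto simp: O'_def)
    obtain W where W: "openin Y W" "y \<in> W"
      "\<And>z K'. \<lbrakk>z \<in> W; supports p z K'; card K' \<le> q\<rbrakk> \<Longrightarrow> K' \<subseteq> G n"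
      using supports_upper_semicontinuous[OF y K(1,2) G K(3)] by blast
    have "W \<inter> exact_support p q \<subseteq> O' n"
    proof
      fix z assume z: "z \<in> W \<inter> exact_support p q"
      then obtain K' where "supports p z K'" "card K' \<le> q"
        using exact_supportE by blast
      with z W(3) show "z \<in> O' n" by (auto simp: O'_def)
    qed
    moreover have "openin S (W \<inter> exact_support p q)"
      unfolding S_def using W(1) by (rule openin_subtopology_Int)
    ultimately show "\<exists>V. openin S V \<and> y \<in> V \<and> V \<subseteq> O' n"
      using W(2) y by blast
  qed
  then have gd: "gdelta_in S (\<Inter>(range O'))"
    by (intro gdelta_in_Inter) (auto intro: open_imp_gdelta_in)
  have "\<Inter>(range O') \<subseteq> (\<Union>K\<in>{K. finite K \<and> K \<subseteq> D}. {y \<in> topspace Y. supports p y K})"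
  proof
    fix y assume y: "y \<in> \<Inter>(range O')"
    then have yE: "y \<in> exact_support p q" by (auto simp: O'_def)
    then obtain K where K: "supports p y K" "card K \<le> q"
      using exact_supportE by blast
    \<comment> \<open>The support inside \<open>G n\<close> may vary with \<open>n\<close>.
      Semicontinuity used at \<open>y\<close> itself puts the one fixed \<open>K\<close> into every
      \<open>G n\<close>.\<close>
    have "K \<subseteq> G n" for n
    proof -
      obtain K' where K': "supports p y K'" "card K' \<le> q" "K' \<subseteq> G n"
        using y by (auto simp: O'_def)
      show ?thesis
      proof (rule supports_upper_semicontinuous[OF yE K'(1,2) G K'(3)])
        fix W assume "y \<in> W" and W: "\<And>z K'. \<lbrakk>z \<in> W; supports p z K'; card K' \<le> q\<rbrakk> \<Longrightarrow> K' \<subseteq> G n"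
        show "K \<subseteq> G n" using \<open>y \<in> W\<close> K by (rule W)
      qed
    qed
    then have "K \<subseteq> D" using G_D by blast
    then have "K \<in> {K. finite K \<and> K \<subseteq> D}" using supports_finite[OF K(1)] by simp
    moreover have "y \<in> {y \<in> topspace Y. supports p y K}" using K(1) yE sub_Y by auto
    ultimately show "y \<in> (\<Union>K\<in>{K. finite K \<and> K \<subseteq> D}. {y \<in> topspace Y. supports p y K})"
      by (rule UN_I)
  qed
  moreover have "countable (\<Union>K\<in>{K. finite K \<and> K \<subseteq> D}. {y \<in> topspace Y. supports p y K})"
    using countable_Collect_finite_subset[OF D(1)] countable_finite[OF finite_supported_points]
    by (rule countable_UN)
  ultimately have cnt: "countable (\<Inter>(range O'))" by (rule countable_subset)
  have "C \<subseteq> O' n" for n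
  proof
    fix y assume y: "y \<in> C"
    then have "K y \<subseteq> G n" using G_D by (auto simp: D_def)
    with K[OF y] y C(2) show "y \<in> O' n" by (auto simp: O'_def)
  qed
  then have "C \<subseteq> \<Inter>(range O')" by (rule INT_greatest)
  \<comment> \<open>The surplus points are countably many and closed, so their union is
    \<open>F\<^sub>\<sigma>\<close> and may be removed.\<close>
  then have eq: "C = \<Inter>(range O') - (\<Union>y\<in>\<Inter>(range O') - C. {y})" by auto
  have "t1_space S"
    unfolding S_def using metrizable_imp_t1_space[OF metY] by (rule t1_space_subtopology)
  then have "closedin S {y}" if "y \<in> \<Inter>(range O')" for y
    using that topS by (auto simp: t1_space_closedin_singleton O'_def)
  then have "fsigma_in S (\<Union>y\<in>\<Inter>(range O') - C. {y})"
    using cnt by (intro fsigma_in_Union) (auto intro: closed_imp_fsigma_in)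
  with gd have "gdelta_in S C" by (subst eq) (rule gdelta_in_diff)
  then show ?thesis by (simp add: S_def)
qed

text \<open>Complements are used because countable unions preserve \<open>F\<^sub>\<sigma>\<close>
  sets: in each piece the complement of \<open>C\<close> is \<open>F\<^sub>\<sigma>\<close>, and it
  stays so in \<open>Y\<close> because the piece itself is.\<close>

lemma gdelta_in_countable:
  assumes X_gd: "\<And>D. countable D \<Longrightarrow> D \<subseteq> topspace X \<Longrightarrow> gdelta_in X D"
    and C: "countable C" "C \<subseteq> topspace Y"
  shows "gdelta_in Y C"
proof -
  have part: "fsigma_in Y (exact_support p q - C)" for p q
  proof -
    have E: "fsigma_in Y (exact_support p q)"
    proof -
      have "gdelta_in Y (small_support (2 * real p) q)"
        using metY closedin_small_support by (rule closed_imp_gdelta_in)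
      moreover have "fsigma_in Y (small_support (real p) (Suc q))"
        using closedin_small_support by (rule closed_imp_fsigma_in)
      ultimately show ?thesis
        unfolding exact_support_def by (intro fsigma_in_diff)
    qed
    have "gdelta_in (subtopology Y (exact_support p q)) (C \<inter> exact_support p q)"
      using C(1) by (intro gdelta_in_countable_Int_exact_support X_gd) auto
    then have "fsigma_in (subtopology Y (exact_support p q)) (exact_support p q - C \<inter> exact_support p q)"
      using fsigma_in_subset[OF E] unfolding gdelta_in_fsigma_in
      by (simp only: topspace_subtopology_subset)
    then have "fsigma_in Y (exact_support p q - C \<inter> exact_support p q)"
      using fsigma_in_fsigma_subtopology[OF E] by blast
    then show ?thesis by (simp add: Diff_Int2 Diff_Int)
  qed
  have "topspace Y - C = (\<Union>(p, q)\<in>UNIV. exact_support p q - C)"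
  proof
    show "topspace Y - C \<subseteq> (\<Union>(p, q)\<in>UNIV. exact_support p q - C)"
    proof
      fix y assume y: "y \<in> topspace Y - C"
      then obtain p q where "y \<in> exact_support p q"
        using exact_support_cover by (metis DiffD1)
      with y show "y \<in> (\<Union>(p, q)\<in>UNIV. exact_support p q - C)" by auto
    qed
    show "(\<Union>(p, q)\<in>UNIV. exact_support p q - C) \<subseteq> topspace Y - C"
      by (auto simp: exact_support_def small_support_def)
  qed
  moreover have "fsigma_in Y (\<Union>(p, q)\<in>UNIV. exact_support p q - C)"
    by (intro fsigma_in_Union) (auto intro: part)
  ultimately show ?thesis
    using C(2) by (simp add: gdelta_in_fsigma_in)
qed

end

theorem theorem4p9:
  fixes X :: "'a topology" and Y :: "'b topology"
    and DX :: "('a \<Rightarrow> real) set" and DY :: "('b \<Rightarrow> real) set"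
    and T :: "('a \<Rightarrow> real) \<Rightarrow> ('b \<Rightarrow> real)"
  assumes "metrizable_space X" and "metrizable_space Y"
    and "DX = C_space X \<or> DX = Cb_space X"
    and "DY = C_space Y \<or> DY = Cb_space Y"
    and "unif_continuous_Dp X DX Y DY T"
    and "T ` DX = DY"
    and "inversely_bounded X Y T"
    and "Delta1_space X"
  shows "Delta1_space Y"
proof -
  interpret Dp_map X Y DX DY T
    using assms by unfold_locales
  show ?thesis
  proof (rule countable_gdelta_in_imp_Delta1)
    show "t1_space Y" using assms(2) by (rule metrizable_imp_t1_space)
    show "gdelta_in Y C" if "countable C" "C \<subseteq> topspace Y" for C
      using Delta1_imp_countable_gdelta_in[OF assms(1,8)] that
      by (rule gdelta_in_countable)
  qed
qed

end
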